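(* Let $(\mathcal{A},\varphi,\varphi')$ be an infinitesimal probability space and let $x_1,x_2\in\mathcal{A}$ be infinitesimally free, with $x_2$ an infinitesimal operator. Let $p=x_1x_2+x_2x_1$, $\alpha=m_1(x_1)+\sqrt{m_2(x_1)}$ and $\beta=m_1(x_1)-\sqrt{m_2(x_1)}$. Then $p$ is an infinitesimal operator, and for all $n\ge 1$ $$\kappa'_n(p)=m'_n(p)=\kappa'_n(\alpha x_2)+\kappa'_n(\beta x_2).$$ Moreover, $g_p=g_{\alpha x_2}+g_{\beta x_2}$ and $r_p=r_{\alpha x_2}+r_{\beta x_2}$ (as formal power series).
   Context: An infinitesimal probability space $(\mathcal{A},\varphi,\varphi')$ is a unital algebra $\mathcal{A}$ over $\mathbb{C}$ with linear functionals $\varphi,\varphi':\mathcal{A}\to\mathbb{C}$ such that $\varphi(1)=1$ and $\varphi'(1)=0$. For $a\in\mathcal{A}$: $m_n(a)=\varphi(a^n)$, $m_n'(a)=\varphi'(a^n)$. An element $a$ is an infinitesimal operator if $\varphi(a^n)=0$ for all $n\geq 1$. Unital subalgebras $(\mathcal{A}_i)_{i\in I}$ are infinitesimally free if, whenever $a_k\in\mathcal{A}_{i_k}$ with $i_1\ne i_2\ne\cdots\ne i_n$ (consecutive indices distinct) and $\varphi(a_k)=0$ for all $k$, one has $\varphi(a_1\cdots a_n)=0$ and $\varphi'(a_1\cdots a_n)=\sum_{k=1}^n\varphi'(a_k)\varphi(a_1\cdots a_{k-1}a_{k+1}\cdots a_n)$. Elements $x_1,x_2$ are infinitesimally free if the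 unital algebras they generate are. Let $NC(n)$ be the non-crossing partitions of $[n]=\{1,\dots,n\}$. For multilinear functionals $f_n:\mathcal{A}^n\to\mathbb{C}$ and $\pi\in NC(n)$, $f_\pi(a_1,\dots,a_n)=\prod_{V\in\pi}f_{|V|}((a_1,\dots,a_n)|_V)$, where $(a_1,\dots,a_n)|_V=(a_{i_1},\dots,a_{i_s})$ for $V=\{i_1<\cdots<i_s\}$; given also $f'_n:\mathcal{A}^n\to\mathbb{C}$, $\partial f_\pi=\sum_{V\in\pi}\partial f_{\pi,V}$, where $\partial f_{\pi,V}$ is $f_\pi$ with the factor $f_{|V|}$ of the block $V$ replaced by $f'_{|V|}$. The free cumulants $\kappa_n$ and infinitesimal free cumulants $\kappa_n'$ are defined inductively by $\varphi(a_1\cdots a_n)=\sum_{\pi\in NC(n)}\kappa_\pi(a_1,\dots,a_n)$ and $\varphi'(a_1\cdots a_n)=\sum_{\pi\in NC(n)}\partial\kappa_\pi(a_1,\dots,a_n)$. Write $\kappa'_n(a)=\kappa_n'(a,\dots,a)$. The infinitesimal Cauchy transform and infinitesimal $r$-transform of $a$ are the formal series $g_a(z)=\sum_{n\ge1}m_n'(a)z^{-(n+1)}$ and $r_a(z)=\sum_{n\ge0}\kappa'_{n+1}(a)z^n$. Here $\sqrt{m_2(x_1)}$ is a fixed square root of $m_2(x_1)$. *)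

theory Defs
  imports Complex_Main "HOL-Library.Disjoint_Sets" "HOL-Computational_Algebra.Formal_Power_Series"
begin

text \<open>A unital algebra over the complex numbers is a type of class \<open>ring_1\<close> together with a
  complex scalar multiplication \<open>scale\<close>. The class requires \<open>0 \<noteq> 1\<close>, which \<open>\<phi> 1 = 1\<close> forces
  anyway.\<close>

locale complex_algebra = vector_space scale
  for scale :: "complex \<Rightarrow> 'a::ring_1 \<Rightarrow> 'a" +
  assumes scale_mult_left: "scale c x * y = scale c (x * y)"
    and scale_mult_right: "x * scale c y = scale c (x * y)"

locale inf_prob_space = complex_algebra scale
  for scale :: "complex \<Rightarrow> 'a::ring_1 \<Rightarrow> 'a" +
  fixes \<phi> \<phi>' :: "'a \<Rightarrow> complex"
  assumes linear_phi: "Vector_Spaces.linear scale (*) \<phi>"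
    and linear_phi': "Vector_Spaces.linear scale (*) \<phi>'"
    and phi_one: "\<phi> 1 = 1"
    and phi'_one: "\<phi>' 1 = 0"

text \<open>Used for both \<open>m\<^sub>n(a)\<close> (with \<open>\<phi>\<close>) and \<open>m'\<^sub>n(a)\<close> (with \<open>\<phi>'\<close>).\<close>

definition moment :: "('a::ring_1 \<Rightarrow> complex) \<Rightarrow> nat \<Rightarrow> 'a \<Rightarrow> complex" where
  "moment \<phi> n a = \<phi> (a ^ n)"

definition inf_operator :: "('a::ring_1 \<Rightarrow> complex) \<Rightarrow> 'a \<Rightarrow> bool" where
  "inf_operator \<phi> a \<longleftrightarrow> (\<forall>n\<ge>1. \<phi> (a ^ n) = 0)"


section \<open>Infinitesimal freeness\<close>

definition unital_subalgebra :: "(complex \<Rightarrow> 'a::ring_1 \<Rightarrow> 'a) \<Rightarrow> 'a set \<Rightarrow> bool" where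
  "unital_subalgebra scale B \<longleftrightarrow>
     1 \<in> B \<and> (\<forall>x\<in>B. \<forall>y\<in>B. x + y \<in> B) \<and> (\<forall>c. \<forall>x\<in>B. scale c x \<in> B) \<and> (\<forall>x\<in>B. \<forall>y\<in>B. x * y \<in> B)"

definition generated_algebra :: "(complex \<Rightarrow> 'a::ring_1 \<Rightarrow> 'a) \<Rightarrow> 'a \<Rightarrow> 'a set" where
  "generated_algebra scale x = unital_subalgebra scale hull {x}"

lemma unital_subalgebra_generated: "unital_subalgebra scale (generated_algebra scale x)"
  unfolding generated_algebra_def
  by (rule hull_in) (auto simp: unital_subalgebra_def)

text \<open>The letters are \<open>a 0, \<dots>, a (n - 1)\<close>. The restriction \<open>n \<ge> 1\<close> excludes the empty word, whose
  product is \<open>1\<close>.\<close>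

definition inf_free ::
  "(complex \<Rightarrow> 'a::ring_1 \<Rightarrow> 'a) \<Rightarrow> ('a \<Rightarrow> complex) \<Rightarrow> ('a \<Rightarrow> complex) \<Rightarrow> 'i set \<Rightarrow> ('i \<Rightarrow> 'a set) \<Rightarrow> bool"
where
  "inf_free scale \<phi> \<phi>' I B \<longleftrightarrow>
     (\<forall>i\<in>I. unital_subalgebra scale (B i)) \<and>
     (\<forall>n\<ge>1. \<forall>(i :: nat \<Rightarrow> 'i) (a :: nat \<Rightarrow> 'a).
        (\<forall>k<n. i k \<in> I \<and> a k \<in> B (i k) \<and> \<phi> (a k) = 0) \<and>
        (\<forall>k. Suc k < n \<longrightarrow> i k \<noteq> i (Suc k)) \<longrightarrow>
          \<phi> (prod_list (map a [0..<n])) = 0 \<and>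
          \<phi>' (prod_list (map a [0..<n])) =
            (\<Sum>k<n. \<phi>' (a k) * \<phi> (prod_list (map a ([0..<k] @ [Suc k..<n])))))"

definition inf_free_elements ::
  "(complex \<Rightarrow> 'a::ring_1 \<Rightarrow> 'a) \<Rightarrow> ('a \<Rightarrow> complex) \<Rightarrow> ('a \<Rightarrow> complex) \<Rightarrow> 'a \<Rightarrow> 'a \<Rightarrow> bool"
where
  "inf_free_elements scale \<phi> \<phi>' x1 x2 \<longleftrightarrow>
     inf_free scale \<phi> \<phi>' {1, 2 :: nat} (\<lambda>i. generated_algebra scale (if i = 1 then x1 else x2))"


section \<open>Non-crossing partitions and cumulants\<close>

text \<open>Partitions are taken of \<open>{0, \<dots>, n - 1}\<close> rather than \<open>{1, \<dots>, n}\<close>, to match list positions.\<close>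

definition NC :: "nat \<Rightarrow> nat set set set" where
  "NC n = {\<pi>. partition_on {..<n} \<pi> \<and>
     \<not> (\<exists>V\<in>\<pi>. \<exists>W\<in>\<pi>. V \<noteq> W \<and> (\<exists>a b c d. a < b \<and> b < c \<and> c < d \<and> a \<in> V \<and> c \<in> V \<and> b \<in> W \<and> d \<in> W))}"

text \<open>A family of functionals \<open>f\<^sub>n\<close> on n-tuples is a single function on lists, \<open>f\<^sub>n\<close> being its
  restriction to lists of length n. The restriction of a tuple to a block \<open>V\<close> is \<open>nths xs V\<close>.\<close>

definition part_prod :: "('a list \<Rightarrow> complex) \<Rightarrow> nat set set \<Rightarrow> 'a list \<Rightarrow> complex" where
  "part_prod f \<pi> xs = (\<Prod>V\<in>\<pi>. f (nths xs V))"

definition part_deriv ::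
  "('a list \<Rightarrow> complex) \<Rightarrow> ('a list \<Rightarrow> complex) \<Rightarrow> nat set set \<Rightarrow> 'a list \<Rightarrow> complex" where
  "part_deriv f f' \<pi> xs = (\<Sum>V\<in>\<pi>. f' (nths xs V) * (\<Prod>W\<in>\<pi> - {V}. f (nths xs W)))"

lemma part_prod_cong [fundef_cong]:
  assumes "\<pi> = \<rho>" "xs = ys" "\<And>V. V \<in> \<rho> \<Longrightarrow> f (nths ys V) = g (nths ys V)"
  shows "part_prod f \<pi> xs = part_prod g \<rho> ys"
  using assms by (simp add: part_prod_def)

lemma part_deriv_cong [fundef_cong]:
  assumes "\<pi> = \<rho>" "xs = ys"
    and "\<And>V. V \<in> \<rho> \<Longrightarrow> f (nths ys V) = g (nths ys V)"
    and "\<And>V. V \<in> \<rho> \<Longrightarrow> f' (nths ys V) = g' (nths ys V)"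
  shows "part_deriv f f' \<pi> xs = part_deriv g g' \<rho> ys"
  using assms by (simp add: part_deriv_def)

lemma finite_NC: "finite (NC n)"
  by (rule finite_subset[of _ "Pow (Pow {..<n})"]) (auto simp: NC_def partition_on_def)

lemma one_block_in_NC:
  assumes "n \<ge> 1"
  shows "{{..<n}} \<in> NC n"
proof -
  have "{..<n} \<noteq> {}"
    using assms by (simp add: lessThan_empty_iff)
  then show ?thesis
    by (auto simp: NC_def partition_on_def)
qed

lemma length_nths_block_less:
  assumes "\<pi> \<in> NC (length xs) - {{{..<length xs}}}" "V \<in> \<pi>"
  shows "length (nths xs V) < length xs"
proof -
  have P: "partition_on {..<length xs} \<pi>" and ne: "\<pi> \<noteq> {{..<length xs}}"
    using assms by (auto simp: NC_def)
  have sub: "V \<subseteq> {..<length xs}"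
    using P assms(2) by (auto simp: partition_on_def)
  have "V \<noteq> {..<length xs}"
  proof
    assume eq: "V = {..<length xs}"
    have "W = V" if W: "W \<in> \<pi>" for W
    proof (rule ccontr)
      assume "W \<noteq> V"
      then have "disjnt W V"
        using P W assms(2) by (auto simp: partition_on_def pairwise_def disjoint_def disjnt_def)
      moreover have "W \<subseteq> V" "W \<noteq> {}"
        using P W eq by (auto simp: partition_on_def)
      ultimately show False
        by (auto simp: disjnt_def)
    qed
    with assms(2) have "\<pi> = {V}"
      by blast
    with eq ne show False
      by simp
  qed
  with sub have "card V < length xs"
    using psubset_card_mono[of "{..<length xs}" V] by auto
  moreover have "{i. i < length xs \<and> i \<in> V} = V"
    using sub by auto
  ultimately show ?thesis
    by (simp add: length_nths)
qed

text \<open>The one-block term of the moment-cumulant formula is solved for; the formulas themselves are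
  \<open>moment_cumulant\<close> and \<open>inf_moment_cumulant\<close> below.\<close>

function free_cumulant :: "('a::ring_1 \<Rightarrow> complex) \<Rightarrow> 'a list \<Rightarrow> complex" where
  "free_cumulant \<phi> xs =
     \<phi> (prod_list xs) -
     (\<Sum>\<pi>\<in>NC (length xs) - {{{..<length xs}}}. part_prod (\<lambda>ys. free_cumulant \<phi> ys) \<pi> xs)"
  by auto
termination
  by (relation "measure (\<lambda>(\<phi>, xs). length xs)") (use length_nths_block_less in auto)

function inf_free_cumulant ::
  "('a::ring_1 \<Rightarrow> complex) \<Rightarrow> ('a \<Rightarrow> complex) \<Rightarrow> 'a list \<Rightarrow> complex" where
  "inf_free_cumulant \<phi> \<phi>' xs =
     \<phi>' (prod_list xs) -
     (\<Sum>\<pi>\<in>NC (length xs) - {{{..<length xs}}}.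
        part_deriv (free_cumulant \<phi>) (\<lambda>ys. inf_free_cumulant \<phi> \<phi>' ys) \<pi> xs)"
  by auto
termination
  by (relation "measure (\<lambda>(\<phi>, \<phi>', xs). length xs)") (use length_nths_block_less in auto)

declare free_cumulant.simps [simp del] inf_free_cumulant.simps [simp del]

lemma nths_lessThan_length: "nths xs {..<length xs} = xs"
  by simp

lemma moment_cumulant:
  assumes "length xs \<ge> 1"
  shows "\<phi> (prod_list xs) = (\<Sum>\<pi>\<in>NC (length xs). part_prod (free_cumulant \<phi>) \<pi> xs)"
  using sum.remove[OF finite_NC one_block_in_NC[OF assms], of "\<lambda>\<pi>. part_prod (free_cumulant \<phi>) \<pi> xs"]
  by (simp add: part_prod_def nths_lessThan_length free_cumulant.simps[of \<phi> xs])

lemma inf_moment_cumulant: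
  assumes "length xs \<ge> 1"
  shows "\<phi>' (prod_list xs) =
    (\<Sum>\<pi>\<in>NC (length xs). part_deriv (free_cumulant \<phi>) (inf_free_cumulant \<phi> \<phi>') \<pi> xs)"
  using sum.remove[OF finite_NC one_block_in_NC[OF assms],
      of "\<lambda>\<pi>. part_deriv (free_cumulant \<phi>) (inf_free_cumulant \<phi> \<phi>') \<pi> xs"]
  by (simp add: part_deriv_def nths_lessThan_length inf_free_cumulant.simps[of \<phi> \<phi>' xs])

definition inf_cumulant ::
  "('a::ring_1 \<Rightarrow> complex) \<Rightarrow> ('a \<Rightarrow> complex) \<Rightarrow> nat \<Rightarrow> 'a \<Rightarrow> complex" where
  "inf_cumulant \<phi> \<phi>' n a = inf_free_cumulant \<phi> \<phi>' (replicate n a)"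


section \<open>Transforms\<close>

text \<open>The infinitesimal Cauchy transform has infinitely many negative powers of \<open>z\<close>, so it is encoded as
  a formal power series in \<open>w = 1 / z\<close>: the coefficient of \<open>w\<^sup>k\<close> is that of \<open>z\<close> to the power \<open>-k\<close>.\<close>

definition inf_cauchy :: "('a::ring_1 \<Rightarrow> complex) \<Rightarrow> 'a \<Rightarrow> complex fps" where
  "inf_cauchy \<phi>' a = Abs_fps (\<lambda>k. if k \<ge> 2 then moment \<phi>' (k - 1) a else 0)"

definition inf_r_transform ::
  "('a::ring_1 \<Rightarrow> complex) \<Rightarrow> ('a \<Rightarrow> complex) \<Rightarrow> 'a \<Rightarrow> complex fps" where
  "inf_r_transform \<phi> \<phi>' a = Abs_fps (\<lambda>n. inf_cumulant \<phi> \<phi>' (n + 1) a)"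

end

theory Submission
  imports Defs
begin

text \<open>The cumulants disappear first. If \<open>a\<close> is an infinitesimal operator, all its free cumulants vanish,
  so in the infinitesimal moment-cumulant formula every partition with two or more blocks contributes
  zero and \<open>\<kappa>'\<^sub>n(a) = m'\<^sub>n(a)\<close> (\<open>inf_cumulant_inf_operator\<close>). This applies to \<open>\<alpha> x\<^sub>2\<close> and \<open>\<beta> x\<^sub>2\<close>, and to
  \<open>p\<close> once \<open>p\<close> is known to be an infinitesimal operator. Everything then reduces to the moment identity
  \<open>\<phi>'(p\<^sup>n) = (\<alpha>\<^sup>n + \<beta>\<^sup>n) \<phi>'(x\<^sub>2\<^sup>n)\<close> (\<open>phi'_p_power\<close>).

  For the moments, call a product of centred elements of the algebra of \<open>x\<^sub>1\<close> alternating with positive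
  powers of \<open>x\<^sub>2\<close> a reduced word. By freeness \<open>\<phi>\<close> vanishes on a nonempty reduced word. Deleting one
  letter from a reduced word with two powers of \<open>x\<^sub>2\<close> leaves a product in which \<open>x\<^sub>2\<close> still occurs, and
  \<open>\<phi>\<close> of such a product is zero because \<open>x\<^sub>2\<close> is infinitesimal; so \<open>\<phi>'\<close> vanishes on reduced words with
  at least two powers of \<open>x\<^sub>2\<close> (\<open>phi'_zero_on_K\<close>). Hence, under \<open>\<phi>'\<close>, an element \<open>b\<close> of the algebra of \<open>x\<^sub>1\<close>
  that stands between two occurrences of \<open>x\<^sub>2\<close> may be replaced by the scalar \<open>\<phi>(b)\<close> (\<open>phi'_step\<close>), while
  the two outer elements \<open>a\<close>, \<open>b\<close> give the factor \<open>\<phi>(a b)\<close> (\<open>phi'_x2_power_between\<close>).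

  In the expansion of \<open>p\<^sup>n\<close> each factor is \<open>x\<^sub>1 x\<^sub>2\<close> or \<open>x\<^sub>2 x\<^sub>1\<close>, and two neighbouring factors enclose
  \<open>x\<^sub>1\<close>, \<open>1\<close>, \<open>x\<^sub>1\<^sup>2\<close> or \<open>x\<^sub>1\<close> between their \<open>x\<^sub>2\<close>'s. With \<open>m = m\<^sub>1(x\<^sub>1)\<close> this makes
  \<open>\<phi>'(p\<^sup>n)\<close> equal to \<open>\<phi>'(x\<^sub>2\<^sup>n)\<close> times the trace of the \<open>n\<close>-th power of the transfer matrix with diagonal entries \<open>m\<close>, \<open>m\<close>
  and off-diagonal entries \<open>1\<close>, \<open>m\<^sub>2(x\<^sub>1)\<close>. Its eigenvalues are \<open>m \<plusminus> \<surd>m\<^sub>2(x\<^sub>1)\<close>, that is, \<open>\<alpha>\<close> and \<open>\<beta>\<close>.\<close>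

section \<open>Cumulants of an infinitesimal operator\<close>

lemma nths_replicate_block:
  assumes "V \<subseteq> {..<n}"
  shows "nths (replicate n a) V = replicate (card V) a"
proof -
  have "{i. i < n \<and> i \<in> V} = V"
    using assms by auto
  then have "length (nths (replicate n a) V) = card V"
    by (simp add: length_nths)
  moreover have "\<forall>y\<in>set (nths (replicate n a) V). y = a"
    using set_nths_subset[of "replicate n a" V] by auto
  ultimately show ?thesis
    by (metis replicate_length_same)
qed

lemma NC_block:
  assumes "\<pi> \<in> NC n" "V \<in> \<pi>"
  shows "V \<subseteq> {..<n}" "1 \<le> card V"
proof -
  show sub: "V \<subseteq> {..<n}"
    using assms by (auto simp: NC_def partition_on_def)
  have "V \<noteq> {}"
    using assms by (auto simp: NC_def partition_on_def)
  moreover have "finite V"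
    using sub finite_subset by blast
  ultimately show "1 \<le> card V"
    by (simp add: Suc_le_eq card_gt_0_iff)
qed

text \<open>In the formula that is solved for \<open>\<kappa>\<^sub>n\<close>, the moment is zero, and a partition other than the one-block
  one has a factor \<open>\<kappa>\<^sub>k\<close> with \<open>1 \<le> k < n\<close>, zero by induction.\<close>

lemma free_cumulant_inf_operator:
  assumes "inf_operator \<phi> a" "1 \<le> n"
  shows "free_cumulant \<phi> (replicate n a) = 0"
  using assms(2)
proof (induction n rule: less_induct)
  case (less n)
  have "part_prod (free_cumulant \<phi>) \<pi> (replicate n a) = 0"
    if \<pi>: "\<pi> \<in> NC n - {{{..<n}}}" for \<pi>
  proof -
    have partition: "partition_on {..<n} \<pi>"
      using \<pi> by (simp add: NC_def)
    have "\<Union> \<pi> \<noteq> {}"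
      using partition less.prems by (simp add: partition_on_def lessThan_empty_iff)
    then obtain V where V: "V \<in> \<pi>"
      by blast
    have nths: "nths (replicate n a) V = replicate (card V) a" and pos: "1 \<le> card V"
      using NC_block[of \<pi> n V] \<pi> V by (auto intro: nths_replicate_block)
    have "length (nths (replicate n a) V) < length (replicate n a)"
      by (rule length_nths_block_less[OF _ V]) (use \<pi> in simp)
    then have "free_cumulant \<phi> (nths (replicate n a) V) = 0"
      using less.IH[OF _ pos] by (simp add: nths)
    moreover have "finite \<pi>"
      by (rule finite_elements[OF finite_lessThan partition])
    ultimately show ?thesis
      using V unfolding part_prod_def by (intro prod_zero) auto
  qed
  then have "(\<Sum>\<pi>\<in>NC n - {{{..<n}}}. part_prod (free_cumulant \<phi>) \<pi> (replicate n a)) = 0"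
    by (rule sum.neutral[OF ballI])
  then show ?case
    using assms(1) less.prems
    by (subst free_cumulant.simps) (simp add: inf_operator_def)
qed

text \<open>Differentiating one block of a partition leaves, unless it is the only block, an ordinary free cumulant
  as a factor, and that is zero.\<close>

lemma inf_cumulant_inf_operator:
  assumes "inf_operator \<phi> a" "1 \<le> n"
  shows "inf_cumulant \<phi> \<phi>' n a = moment \<phi>' n a"
proof -
  have "part_deriv (free_cumulant \<phi>) (inf_free_cumulant \<phi> \<phi>') \<pi> (replicate n a) = 0"
    if \<pi>: "\<pi> \<in> NC n - {{{..<n}}}" for \<pi>
  proof -
    have partition: "partition_on {..<n} \<pi>"
      using \<pi> by (simp add: NC_def)
    have fin: "finite \<pi>"
      by (rule finite_elements[OF finite_lessThan partition])
    have "(\<Prod>W\<in>\<pi> - {V}. free_cumulant \<phi> (nths (replicate n a) W)) = 0" if V: "V \<in> \<pi>" for V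
    proof -
      have "\<pi> \<noteq> {V}"
        using \<pi> partition by (auto simp: partition_on_def)
      then obtain W where W: "W \<in> \<pi> - {V}"
        using V by blast
      have "free_cumulant \<phi> (nths (replicate n a) W) = 0"
        using NC_block[of \<pi> n W] \<pi> W
        by (simp add: nths_replicate_block free_cumulant_inf_operator[OF assms(1)])
      then show ?thesis
        using W fin by (intro prod_zero) auto
    qed
    then show ?thesis
      by (simp add: part_deriv_def)
  qed
  then have "(\<Sum>\<pi>\<in>NC n - {{{..<n}}}.
      part_deriv (free_cumulant \<phi>) (inf_free_cumulant \<phi> \<phi>') \<pi> (replicate n a)) = 0"
    by (rule sum.neutral[OF ballI])
  then show ?thesis
    unfolding inf_cumulant_def moment_def by (subst inf_free_cumulant.simps) simp
qed

section \<open>Words in infinitesimally free elements, one of them infinitesimal\<close>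

locale free_with_infinitesimal = inf_prob_space scale \<phi> \<phi>'
  for scale :: "complex \<Rightarrow> 'a::ring_1 \<Rightarrow> 'a" and \<phi> \<phi>' :: "'a \<Rightarrow> complex" +
  fixes x1 x2 :: 'a
  assumes free: "inf_free_elements scale \<phi> \<phi>' x1 x2"
    and infinitesimal: "inf_operator \<phi> x2"
begin

abbreviation B :: "'a set" where "B \<equiv> generated_algebra scale x1"

lemma phi_add: "\<phi> (u + v) = \<phi> u + \<phi> v" and phi_scale: "\<phi> (scale c u) = c * \<phi> u"
  and phi_diff: "\<phi> (u - v) = \<phi> u - \<phi> v"
  and phi'_add: "\<phi>' (u + v) = \<phi>' u + \<phi>' v" and phi'_scale: "\<phi>' (scale c u) = c * \<phi>' u"
  and phi'_diff: "\<phi>' (u - v) = \<phi>' u - \<phi>' v"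
proof -
  interpret f: Vector_Spaces.linear scale "(*)" \<phi> by (rule linear_phi)
  interpret f': Vector_Spaces.linear scale "(*)" \<phi>' by (rule linear_phi')
  show "\<phi> (u + v) = \<phi> u + \<phi> v" "\<phi> (scale c u) = c * \<phi> u" "\<phi> (u - v) = \<phi> u - \<phi> v"
    "\<phi>' (u + v) = \<phi>' u + \<phi>' v" "\<phi>' (scale c u) = c * \<phi>' u" "\<phi>' (u - v) = \<phi>' u - \<phi>' v"
    by (rule f.add f.scale f.diff f'.add f'.scale f'.diff)+
qed

lemma B_one: "1 \<in> B" and B_mult: "u \<in> B \<Longrightarrow> v \<in> B \<Longrightarrow> u * v \<in> B"
  and B_add: "u \<in> B \<Longrightarrow> v \<in> B \<Longrightarrow> u + v \<in> B" and B_scale: "u \<in> B \<Longrightarrow> scale c u \<in> B"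
  using unital_subalgebra_generated[of scale x1] by (auto simp: unital_subalgebra_def)

lemma B_x1: "x1 \<in> B"
  by (simp add: generated_algebra_def hull_inc)

lemma x2_power_generated: "x2 ^ r \<in> generated_algebra scale x2"
proof (induction r)
  case 0
  then show ?case
    using unital_subalgebra_generated[of scale x2] by (simp add: unital_subalgebra_def)
next
  case (Suc r)
  moreover have "x2 \<in> generated_algebra scale x2"
    by (simp add: generated_algebra_def hull_inc)
  ultimately show ?case
    using unital_subalgebra_generated[of scale x2] by (simp add: unital_subalgebra_def)
qed

definition center :: "'a \<Rightarrow> 'a" where "center b = b - scale (\<phi> b) 1"

lemma center_split: "b = center b + scale (\<phi> b) 1"
  by (simp add: center_def)

lemma phi_center: "\<phi> (center b) = 0"
  by (simp add: center_def phi_diff phi_scale phi_one)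

lemma center_B:
  assumes "b \<in> B"
  shows "center b \<in> B"
proof -
  have "center b = b + scale (- \<phi> b) 1"
    by (simp add: center_def scale_minus_left)
  then show ?thesis
    by (metis B_add B_one B_scale assms)
qed

lemma mult_center_split: "u * b = u * center b + scale (\<phi> b) u"
  by (subst center_split[of b]) (simp add: distrib_left scale_mult_right)

lemma center_mult_split: "b * u = center b * u + scale (\<phi> b) u"
  by (subst center_split[of b]) (simp add: distrib_right scale_mult_left)

text \<open>The flag of a letter tells whether it belongs to \<open>x\<^sub>2\<close>. Letters of \<open>x\<^sub>2\<close> are restricted to positive
  powers: they are centred because \<open>x\<^sub>2\<close> is infinitesimal, and the product of two of them is again one.
  Merging two neighbouring letters of \<open>x\<^sub>2\<close> therefore never produces a scalar, and \<open>x\<^sub>2\<close> cannot disappear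
  from a word.\<close>

fun letter :: "bool \<times> 'a \<Rightarrow> bool" where
  "letter (False, b) \<longleftrightarrow> b \<in> B \<and> \<phi> b = 0"
| "letter (True, c) \<longleftrightarrow> (\<exists>r\<ge>1. c = x2 ^ r)"

definition reduced :: "(bool \<times> 'a) list \<Rightarrow> bool" where
  "reduced ws \<longleftrightarrow> (\<forall>w\<in>set ws. letter w) \<and> successively (\<lambda>v w. fst v \<noteq> fst w) ws"

definition val :: "(bool \<times> 'a) list \<Rightarrow> 'a" where
  "val ws = prod_list (map snd ws)"

definition infinitesimal_letters :: "(bool \<times> 'a) list \<Rightarrow> nat" where
  "infinitesimal_letters ws = length (filter fst ws)"

definition K :: "nat \<Rightarrow> 'a set" where
  "K m = span {val ws |ws. reduced ws \<and> m \<le> infinitesimal_letters ws}"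

lemma reduced_word_in_K: "reduced ws \<Longrightarrow> m \<le> infinitesimal_letters ws \<Longrightarrow> val ws \<in> K m"
  by (auto simp: K_def intro: span_base)

lemma K_antimono: "m \<le> m' \<Longrightarrow> K m' \<subseteq> K m"
  unfolding K_def by (rule span_mono) auto

lemma K_add: "u \<in> K m \<Longrightarrow> v \<in> K m \<Longrightarrow> u + v \<in> K m"
  and K_scale: "u \<in> K m \<Longrightarrow> scale c u \<in> K m"
  by (simp_all add: K_def span_add span_scale)

text \<open>\<open>K 0\<close> contains the whole algebra generated by \<open>x\<^sub>1\<close> and \<open>x\<^sub>2\<close>, and \<open>K 1\<close> the ideal generated by \<open>x\<^sub>2\<close>.
  The lemmas up to \<open>val_letters_in_K\<close> bring products into these spans by multiplying from the right, one
  letter at a time, so that only the last letter of a reduced word is ever changed.\<close>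

lemma K_mult_right:
  assumes u: "u \<in> K m"
    and words: "\<And>ws. reduced ws \<Longrightarrow> m \<le> infinitesimal_letters ws \<Longrightarrow> val ws * v \<in> K m'"
  shows "u * v \<in> K m'"
  using u unfolding K_def[of m]
proof (induction rule: span_induct_alt)
  case base
  then show ?case by (simp add: K_def span_zero)
next
  case (step c w z)
  then have "w * v \<in> K m'"
    using words by auto
  then show ?case
    using K_add[OF K_scale step.IH] by (simp add: distrib_right scale_mult_left step.IH)
qed

lemma linear_zero_on_K:
  assumes "\<And>u v. f (u + v) = f u + f v" "\<And>c u. f (scale c u) = c * f u"
    and "\<And>ws. reduced ws \<Longrightarrow> m \<le> infinitesimal_letters ws \<Longrightarrow> f (val ws) = (0::complex)"
    and u: "u \<in> K m"
  shows "f u = 0"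
  using u unfolding K_def
proof (induction rule: span_induct_alt)
  case base
  show ?case using assms(2)[of 0 0] by simp
next
  case (step c w z)
  then show ?case using assms by auto
qed

lemma reduced_snoc:
  "reduced (ws @ [w]) \<longleftrightarrow> reduced ws \<and> letter w \<and> (ws = [] \<or> fst (last ws) \<noteq> fst w)"
  by (auto simp: reduced_def successively_append_iff)

text \<open>If the word ends in a power of \<open>x\<^sub>2\<close>, the centred part of \<open>b\<close> is appended and its scalar part leaves the
  word unchanged. If it ends in a letter of \<open>x\<^sub>1\<close>, that letter is first absorbed into \<open>b\<close>. Neither case
  loses a power of \<open>x\<^sub>2\<close>.\<close>

lemma reduced_mult_B:
  assumes "reduced ws" "b \<in> B"
  shows "val ws * b \<in> K (infinitesimal_letters ws)"
proof -
  have append: "val us * b' \<in> K (infinitesimal_letters us)"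
    if us: "reduced us" "us = [] \<or> fst (last us)" and b': "b' \<in> B" for us b'
  proof -
    have "reduced (us @ [(False, center b')])"
      using us b' by (auto simp: reduced_snoc center_B phi_center)
    then have "val (us @ [(False, center b')]) \<in> K (infinitesimal_letters us)"
      by (rule reduced_word_in_K) (simp add: infinitesimal_letters_def)
    moreover have "val us \<in> K (infinitesimal_letters us)"
      using us by (simp add: reduced_word_in_K)
    ultimately show ?thesis
      using K_add[OF _ K_scale] by (subst mult_center_split) (simp add: val_def)
  qed
  show ?thesis
  proof (cases "ws = [] \<or> fst (last ws)")
    case True
    then show ?thesis
      using append assms by blast
  next
    case False
    then obtain us a where ws: "ws = us @ [(False, a)]"
      by (cases ws rule: rev_cases) (simp, metis (full_types) last_snoc prod.collapse)
    then have "reduced us" "a \<in> B" "us = [] \<or> fst (last us)"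
      using assms by (auto simp: reduced_snoc)
    from append[OF this(1,3) B_mult[OF this(2) assms(2)]]
    show ?thesis
      by (simp add: ws val_def infinitesimal_letters_def mult.assoc)
  qed
qed

lemma reduced_mult_x2_power:
  assumes "reduced ws" "1 \<le> r"
  shows "val ws * x2 ^ r \<in> K (max 1 (infinitesimal_letters ws))"
proof (cases "ws = [] \<or> \<not> fst (last ws)")
  case True
  then have "reduced (ws @ [(True, x2 ^ r)])"
    using assms by (auto simp: reduced_snoc)
  then have "val (ws @ [(True, x2 ^ r)]) \<in> K (max 1 (infinitesimal_letters ws))"
    by (rule reduced_word_in_K) (simp add: infinitesimal_letters_def)
  then show ?thesis
    by (simp add: val_def)
next
  case False
  then obtain us c where ws: "ws = us @ [(True, c)]"
    by (cases ws rule: rev_cases) (simp, metis (full_types) last_snoc prod.collapse)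
  then obtain q where q: "1 \<le> q" "c = x2 ^ q"
    using assms by (auto simp: reduced_snoc)
  have "reduced (us @ [(True, x2 ^ (q + r))])"
    using assms q by (auto simp: reduced_snoc ws intro!: exI[of _ "q + r"])
  then have "val (us @ [(True, x2 ^ (q + r))]) \<in> K (max 1 (infinitesimal_letters ws))"
    by (rule reduced_word_in_K) (simp add: infinitesimal_letters_def ws)
  then show ?thesis
    by (simp add: val_def ws q power_add mult.assoc)
qed

lemma K_mult_B: "u \<in> K m \<Longrightarrow> b \<in> B \<Longrightarrow> u * b \<in> K m"
  by (rule K_mult_right) (auto dest: reduced_mult_B subsetD[OF K_antimono])

lemma K_mult_x2_power:
  assumes "u \<in> K m" "1 \<le> r"
  shows "u * x2 ^ r \<in> K (max 1 m)"
proof (rule K_mult_right[OF assms(1)])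
  fix ws
  assume "reduced ws" "m \<le> infinitesimal_letters ws"
  then show "val ws * x2 ^ r \<in> K (max 1 m)"
    using reduced_mult_x2_power[OF _ assms(2)] K_antimono[of "max 1 m" "max 1 (infinitesimal_letters ws)"]
    by (auto simp: max.coboundedI2)
qed

lemma K_mult_x2: "u \<in> K m \<Longrightarrow> u * x2 \<in> K (max 1 m)"
  using K_mult_x2_power[of u m 1] by simp

lemma one_in_K: "1 \<in> K 0"
  using reduced_word_in_K[of "[]" 0] by (simp add: reduced_def val_def)

text \<open>The letters need not alternate: this covers the words that remain when freeness deletes an inner letter
  of a reduced word.\<close>

lemma val_letters_in_K:
  assumes "\<forall>w\<in>set ws. letter w"
  shows "val ws \<in> K (min 1 (infinitesimal_letters ws))"
  using assms
proof (induction ws rule: rev_induct)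
  case Nil
  then show ?case
    using one_in_K by (simp add: val_def infinitesimal_letters_def)
next
  case (snoc w ws)
  obtain t a where w: "w = (t, a)"
    by fastforce
  have IH: "val ws \<in> K (min 1 (infinitesimal_letters ws))"
    using snoc by simp
  show ?case
  proof (cases t)
    case True
    then obtain r where "1 \<le> r" "a = x2 ^ r"
      using snoc.prems w by auto
    then have "val ws * a \<in> K 1"
      using K_mult_x2_power[OF IH] K_antimono[of 1 "max 1 (min 1 (infinitesimal_letters ws))"]
      by auto
    then show ?thesis
      using True by (simp add: val_def infinitesimal_letters_def w)
  next
    case False
    then show ?thesis
      using K_mult_B[OF IH] snoc.prems by (simp add: val_def infinitesimal_letters_def w)
  qed
qed

lemma reduced_word_free:
  assumes "reduced ws" "ws \<noteq> []"
  shows "\<phi> (val ws) = 0"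
    and "\<phi>' (val ws) =
      (\<Sum>k<length ws. \<phi>' (snd (ws ! k)) * \<phi> (val (take k ws @ drop (Suc k) ws)))"
proof -
  define i :: "nat \<Rightarrow> nat" where "i k = (if fst (ws ! k) then 2 else 1)" for k
  define a where "a k = snd (ws ! k)" for k
  have letters: "i k \<in> {1, 2} \<and> a k \<in> generated_algebra scale (if i k = 1 then x1 else x2) \<and> \<phi> (a k) = 0"
    if "k < length ws" for k
  proof -
    have "letter (ws ! k)"
      using assms that by (simp add: reduced_def)
    then show ?thesis
      using x2_power_generated infinitesimal
      by (cases "ws ! k"; cases "fst (ws ! k)") (auto simp: i_def a_def inf_operator_def)
  qed
  have alternating: "i k \<noteq> i (Suc k)" if "Suc k < length ws" for k
    using assms that by (auto simp: reduced_def successively_conv_nth i_def)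
  have vals: "map a [0..<length ws] = map snd ws"
    by (rule nth_equalityI) (auto simp: a_def)
  have removed: "map a ([0..<k] @ [Suc k..<length ws]) = map snd (take k ws @ drop (Suc k) ws)"
    if "k < length ws" for k
    by (rule nth_equalityI) (use that in \<open>auto simp: a_def nth_append\<close>)
  have "\<phi> (prod_list (map a [0..<length ws])) = 0 \<and>
    \<phi>' (prod_list (map a [0..<length ws])) =
      (\<Sum>k<length ws. \<phi>' (a k) * \<phi> (prod_list (map a ([0..<k] @ [Suc k..<length ws]))))"
  proof (rule free[unfolded inf_free_elements_def inf_free_def, THEN conjunct2,
        THEN spec[of _ "length ws"], THEN mp, THEN spec[of _ i], THEN spec[of _ a], THEN mp])
    show "1 \<le> length ws"
      using assms(2) by (simp add: Suc_le_eq)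
  qed (use letters alternating in blast)
  then show "\<phi> (val ws) = 0"
    and "\<phi>' (val ws) =
      (\<Sum>k<length ws. \<phi>' (snd (ws ! k)) * \<phi> (val (take k ws @ drop (Suc k) ws)))"
    using removed by (auto simp: vals val_def a_def simp del: map_append intro!: sum.cong)
qed

lemma phi_zero_on_K:
  assumes "u \<in> K 1"
  shows "\<phi> u = 0"
  using phi_add phi_scale _ assms
proof (rule linear_zero_on_K)
  fix ws
  assume "reduced ws" "1 \<le> infinitesimal_letters ws"
  then show "\<phi> (val ws) = 0"
    by (intro reduced_word_free(1)) (auto simp: infinitesimal_letters_def)
qed

text \<open>In the derivation formula each term contains \<open>\<phi>\<close> of the word with one letter deleted. At least one of
  the two powers of \<open>x\<^sub>2\<close> survives, which places the remaining product in \<open>K 1\<close>.\<close>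

lemma phi'_zero_on_K:
  assumes "u \<in> K 2"
  shows "\<phi>' u = 0"
  using phi'_add phi'_scale _ assms
proof (rule linear_zero_on_K)
  fix ws
  assume ws: "reduced ws" "2 \<le> infinitesimal_letters ws"
  have "\<phi> (val (take k ws @ drop (Suc k) ws)) = 0" if k: "k < length ws" for k
  proof -
    define vs where "vs = take k ws @ drop (Suc k) ws"
    have "infinitesimal_letters ws \<le> Suc (infinitesimal_letters vs)"
      by (subst id_take_nth_drop[OF k]) (simp add: infinitesimal_letters_def vs_def)
    moreover have "\<forall>w\<in>set vs. letter w"
      using ws(1) by (auto simp: vs_def reduced_def dest: in_set_takeD in_set_dropD)
    ultimately have "val vs \<in> K 1"
      using val_letters_in_K[of vs] ws(2) by (simp add: min_absorb1)
    then show ?thesis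
      by (simp add: phi_zero_on_K vs_def)
  qed
  moreover have "ws \<noteq> []"
    using ws(2) by (auto simp: infinitesimal_letters_def)
  ultimately show "\<phi>' (val ws) = 0"
    using ws(1) by (simp add: reduced_word_free(2))
qed

section \<open>The anticommutator\<close>

text \<open>After centring \<open>a\<close> and \<open>b\<close>, freeness lets only two terms survive: the one in which the middle letter is
  differentiated, with factor \<open>\<phi>\<close> of the product of the centred parts, and the one with both scalar
  parts. Together these factors make up \<open>\<phi>(a b)\<close>.\<close>

lemma phi'_x2_power_between:
  assumes a: "a \<in> B" and b: "b \<in> B" and r: "1 \<le> r"
  shows "\<phi>' (a * x2 ^ r * b) = \<phi> (a * b) * \<phi>' (x2 ^ r)"
proof -
  let ?c = "x2 ^ r" and ?a = "center a" and ?b = "center b"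
  have c: "\<phi> ?c = 0"
    using infinitesimal r by (simp add: inf_operator_def)
  have red: "reduced [(False, ?a), (True, ?c)]" "reduced [(True, ?c), (False, ?b)]"
    "reduced [(False, ?a), (True, ?c), (False, ?b)]"
    using a b r by (auto simp: reduced_def center_B phi_center)
  have 0: "\<phi> (?a * ?c) = 0" "\<phi> (?c * ?b) = 0"
    using reduced_word_free(1)[OF red(1)] reduced_word_free(1)[OF red(2)] by (simp_all add: val_def)
  have 1: "\<phi>' (?a * ?c) = 0" "\<phi>' (?c * ?b) = 0"
    using reduced_word_free(2)[OF red(1)] reduced_word_free(2)[OF red(2)]
    by (simp_all add: val_def phi_center c)
  have 2: "\<phi>' (?a * ?c * ?b) = \<phi>' ?c * \<phi> (?a * ?b)"
    using reduced_word_free(2)[OF red(3)] 0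
    by (simp add: val_def numeral_3_eq_3 mult.assoc)
  have "a * ?c * b = ?a * ?c * ?b + scale (\<phi> b) (?a * ?c) + scale (\<phi> a) (?c * ?b + scale (\<phi> b) ?c)"
    by (metis center_mult_split mult.assoc mult_center_split)
  moreover have "a * b = ?a * ?b + scale (\<phi> b) ?a + scale (\<phi> a) b"
    by (metis center_mult_split mult_center_split)
  ultimately show ?thesis
    by (simp add: phi_add phi'_add phi_scale phi'_scale 1 2[unfolded mult.assoc] phi_center algebra_simps)
qed

definition p :: 'a where "p = x1 * x2 + x2 * x1"

lemma K_mult_p_power:
  assumes "u \<in> K m"
  shows "u * p ^ n \<in> K m"
proof (induction n)
  case 0
  then show ?case using assms by simp
next
  case (Suc n)
  have x2: "v * x2 \<in> K m" if "v \<in> K m" for v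
    using K_mult_x2[OF that] K_antimono[of m "max 1 m"] by auto
  have "u * p ^ n * x1 * x2 + u * p ^ n * x2 * x1 \<in> K m"
    by (rule K_add[OF x2[OF K_mult_B[OF Suc.IH B_x1]] K_mult_B[OF x2[OF Suc.IH] B_x1]])
  moreover have "u * p ^ Suc n = u * p ^ n * x1 * x2 + u * p ^ n * x2 * x1"
    by (simp only: power_Suc2 p_def distrib_left mult.assoc)
  ultimately show ?case
    by simp
qed

lemma inf_operator_p: "inf_operator \<phi> p"
  unfolding inf_operator_def
proof (intro allI impI)
  fix n :: nat
  assume "1 \<le> n"
  then obtain k where n: "n = Suc k"
    by (cases n) auto
  have "1 * x1 * x2 \<in> K (max 1 0)" "1 * x2 * x1 \<in> K (max 1 0)"
    by (rule K_mult_x2[OF K_mult_B[OF one_in_K B_x1]] K_mult_B[OF K_mult_x2[OF one_in_K] B_x1])+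
  then have "p \<in> K 1"
    unfolding p_def by (intro K_add) simp_all
  then show "\<phi> (p ^ n) = 0"
    using phi_zero_on_K[OF K_mult_p_power[of p 1 k]] by (simp add: n)
qed

text \<open>Replacing \<open>b\<close> by its centred part puts at least two powers of \<open>x\<^sub>2\<close>, kept apart, into the word, so it is
  killed by \<open>\<phi>'\<close>; only the scalar part \<open>\<phi>(b)\<close> remains, and the two powers of \<open>x\<^sub>2\<close> around it join.\<close>

lemma phi'_step:
  assumes a: "a \<in> B" and b: "b \<in> B" and r: "1 \<le> r"
    and v: "\<And>u. u \<in> K 2 \<Longrightarrow> u * v \<in> K 2"
  shows "\<phi>' (a * x2 ^ r * b * x2 * v) = \<phi> b * \<phi>' (a * x2 ^ Suc r * v)"
proof -
  have red: "reduced [(True, x2 ^ r), (False, center b), (True, x2 ^ 1)]"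
    "reduced [(False, center a), (True, x2 ^ r), (False, center b), (True, x2 ^ 1)]"
    using a b r by (auto simp: reduced_def center_B phi_center simp del: power_one_right)
  have "x2 ^ r * center b * x2 \<in> K 2" "center a * (x2 ^ r * center b * x2) \<in> K 2"
    using red[THEN reduced_word_in_K[where m = 2]]
    by (auto simp: infinitesimal_letters_def val_def mult.assoc)
  then have "a * (x2 ^ r * center b * x2) \<in> K 2"
    by (subst center_mult_split) (intro K_add K_scale)
  from phi'_zero_on_K[OF v[OF this]]
  have "\<phi>' (a * (x2 ^ r * center b * x2) * v) = 0" .
  moreover have "a * x2 ^ r * b * x2 * v =
      a * (x2 ^ r * center b * x2) * v + scale (\<phi> b) (a * x2 ^ Suc r * v)"
    by (subst mult_center_split[of _ b])
      (simp add: distrib_right scale_mult_left mult.assoc power_Suc2 del: power_Suc)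
  ultimately show ?thesis
    by (simp add: phi'_add phi'_scale del: power_Suc)
qed

text \<open>One step of the transfer matrix: the leftmost factor of \<open>p\<^bsup>n+1\<^esup>\<close> is \<open>x\<^sub>1 x\<^sub>2\<close> or \<open>x\<^sub>2 x\<^sub>1\<close>, and the element
  enclosed before its \<open>x\<^sub>2\<close> is \<open>b x\<^sub>1\<close> or \<open>b\<close>.\<close>

lemma phi'_step_p:
  assumes "a \<in> B" "b \<in> B" "1 \<le> r"
  shows "\<phi>' (a * x2 ^ r * b * p ^ Suc n) =
    \<phi> (b * x1) * \<phi>' (a * x2 ^ Suc r * p ^ n) + \<phi> b * \<phi>' (a * x2 ^ Suc r * x1 * p ^ n)"
proof -
  have "a * x2 ^ r * b * p ^ Suc n =
      a * x2 ^ r * (b * x1) * x2 * p ^ n + a * x2 ^ r * b * x2 * (x1 * p ^ n)"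
    by (simp add: p_def distrib_left distrib_right mult.assoc)
  moreover have "\<phi>' (a * x2 ^ r * (b * x1) * x2 * p ^ n) = \<phi> (b * x1) * \<phi>' (a * x2 ^ Suc r * p ^ n)"
    by (rule phi'_step[OF assms(1) B_mult[OF assms(2) B_x1] assms(3) K_mult_p_power])
  moreover have "\<phi>' (a * x2 ^ r * b * x2 * (x1 * p ^ n)) = \<phi> b * \<phi>' (a * x2 ^ Suc r * (x1 * p ^ n))"
  proof (rule phi'_step[OF assms])
    fix u
    assume "u \<in> K 2"
    then show "u * (x1 * p ^ n) \<in> K 2"
      using K_mult_p_power[OF K_mult_B[OF _ B_x1], of u 2 n] by (simp add: mult.assoc)
  qed
  ultimately show ?thesis
    by (simp add: phi'_add mult.assoc del: power_Suc)
qed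

text \<open>The recursion \<open>phi'_step_p\<close>, taken for \<open>b = 1\<close> and \<open>b = x\<^sub>1\<close>, is closed. Its solution is the \<open>n\<close>-th power
  of the transfer matrix, with \<open>e n\<close> on the diagonal and \<open>d n\<close>, \<open>m\<^sub>2(x\<^sub>1) d n\<close> off it. For distinct \<open>\<alpha>\<close> and \<open>\<beta>\<close>
  the number \<open>d n\<close> is \<open>(\<alpha>\<^sup>n - \<beta>\<^sup>n) / (\<alpha> - \<beta>)\<close>; the sum extends this quotient to the case \<open>\<alpha> = \<beta>\<close>, that is,
  \<open>s = 0\<close>.\<close>

lemma phi'_x2_power_p_power:
  fixes s \<alpha> \<beta> :: complex
  assumes s: "s ^ 2 = \<phi> (x1 ^ 2)" and \<alpha>: "\<alpha> = \<phi> x1 + s" and \<beta>: "\<beta> = \<phi> x1 - s"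
    and a: "a \<in> B" and r: "1 \<le> r"
  defines "e \<equiv> \<lambda>n. (\<alpha> ^ n + \<beta> ^ n) / 2"
    and "d \<equiv> \<lambda>n. \<Sum>i<n. \<beta> ^ (n - Suc i) * \<alpha> ^ i"
  shows "\<phi>' (a * x2 ^ r * p ^ n) = (e n * \<phi> a + d n * \<phi> (a * x1)) * \<phi>' (x2 ^ (r + n))"
    and "\<phi>' (a * x2 ^ r * x1 * p ^ n) =
      (\<phi> (x1 ^ 2) * d n * \<phi> a + e n * \<phi> (a * x1)) * \<phi>' (x2 ^ (r + n))"
proof -
  have diff: "\<alpha> ^ n - \<beta> ^ n = 2 * s * d n" for n
    using power_diff_sumr2[of \<alpha> n \<beta>] by (simp add: \<alpha> \<beta> d_def)
  have d_Suc: "d (Suc n) = \<phi> x1 * d n + e n" for n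
  proof -
    have "d (Suc n) = \<beta> * d n + \<alpha> ^ n"
      by (simp add: d_def sum_distrib_left Suc_diff_Suc mult.assoc[symmetric] flip: power_Suc)
    also have "\<dots> = \<phi> x1 * d n + e n"
      using diff[of n] by (simp add: e_def \<beta> field_simps)
    finally show ?thesis .
  qed
  have e_Suc: "e (Suc n) = \<phi> x1 * e n + \<phi> (x1 ^ 2) * d n" for n
  proof -
    have "2 * e (Suc n) = \<phi> x1 * (2 * e n) + s * (\<alpha> ^ n - \<beta> ^ n)"
      by (simp add: e_def) (simp add: \<alpha> \<beta> algebra_simps)
    also have "\<dots> = 2 * (\<phi> x1 * e n + \<phi> (x1 ^ 2) * d n)"
      by (simp add: diff flip: s) (simp add: algebra_simps power2_eq_square)
    finally show ?thesis
      by (metis mult_cancel_left zero_neq_numeral)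
  qed
  have "\<phi>' (a * x2 ^ r * p ^ n) = (e n * \<phi> a + d n * \<phi> (a * x1)) * \<phi>' (x2 ^ (r + n)) \<and>
    \<phi>' (a * x2 ^ r * x1 * p ^ n) =
      (\<phi> (x1 ^ 2) * d n * \<phi> a + e n * \<phi> (a * x1)) * \<phi>' (x2 ^ (r + n))"
    using r
  proof (induction n arbitrary: r)
    case 0
    then show ?case
      using phi'_x2_power_between[OF a B_one, of r] phi'_x2_power_between[OF a B_x1, of r]
      by (simp add: e_def d_def)
  next
    case (Suc n)
    have IH: "\<phi>' (a * x2 ^ Suc r * p ^ n) = (e n * \<phi> a + d n * \<phi> (a * x1)) * \<phi>' (x2 ^ (r + Suc n))"
      "\<phi>' (a * x2 ^ Suc r * x1 * p ^ n) =
        (\<phi> (x1 ^ 2) * d n * \<phi> a + e n * \<phi> (a * x1)) * \<phi>' (x2 ^ (r + Suc n))"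
      using Suc.IH[of "Suc r"] by simp_all
    show ?case
      using phi'_step_p[OF a B_one Suc.prems, of n] phi'_step_p[OF a B_x1 Suc.prems, of n]
      unfolding IH e_Suc d_Suc by (simp add: phi_one algebra_simps power2_eq_square)
  qed
  then show "\<phi>' (a * x2 ^ r * p ^ n) = (e n * \<phi> a + d n * \<phi> (a * x1)) * \<phi>' (x2 ^ (r + n))"
    and "\<phi>' (a * x2 ^ r * x1 * p ^ n) =
      (\<phi> (x1 ^ 2) * d n * \<phi> a + e n * \<phi> (a * x1)) * \<phi>' (x2 ^ (r + n))"
    by blast+
qed

text \<open>Splitting off the leftmost factor of \<open>p\<^sup>n\<close> leaves the outer element \<open>x\<^sub>1\<close> or \<open>1\<close> on the left, to which
  \<open>phi'_x2_power_p_power\<close> applies; adding the two contributions forms the trace.\<close>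

lemma phi'_p_power:
  assumes s: "s ^ 2 = \<phi> (x1 ^ 2)" and \<alpha>: "\<alpha> = \<phi> x1 + s" and \<beta>: "\<beta> = \<phi> x1 - s"
    and n: "1 \<le> n"
  shows "\<phi>' (p ^ n) = (\<alpha> ^ n + \<beta> ^ n) * \<phi>' (x2 ^ n)"
proof -
  obtain k where k: "n = Suc k"
    using n by (cases n) auto
  define d where "d = (\<Sum>i<k. \<beta> ^ (k - Suc i) * \<alpha> ^ i)"
  have diff: "\<alpha> ^ k - \<beta> ^ k = 2 * s * d"
    using power_diff_sumr2[of \<alpha> k \<beta>] by (simp add: \<alpha> \<beta> d_def)
  have "p ^ n = x1 * x2 ^ 1 * p ^ k + 1 * x2 ^ 1 * x1 * p ^ k"
    by (simp add: k p_def distrib_right)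
  then have "\<phi>' (p ^ n) = \<phi>' (x1 * x2 ^ 1 * p ^ k) + \<phi>' (1 * x2 ^ 1 * x1 * p ^ k)"
    by (simp only: phi'_add)
  also have "\<dots> = (\<phi> x1 * (\<alpha> ^ k + \<beta> ^ k) + 2 * (s * s) * d) * \<phi>' (x2 ^ n)"
    unfolding phi'_x2_power_p_power(1)[OF s \<alpha> \<beta> B_x1 order_refl]
      phi'_x2_power_p_power(2)[OF s \<alpha> \<beta> B_one order_refl] d_def[symmetric]
    using s by (simp add: k phi_one field_simps power2_eq_square)
  also have "\<phi> x1 * (\<alpha> ^ k + \<beta> ^ k) + 2 * (s * s) * d = \<phi> x1 * (\<alpha> ^ k + \<beta> ^ k) + s * (\<alpha> ^ k - \<beta> ^ k)"
    by (simp add: diff)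
  also have "\<dots> = \<alpha> ^ n + \<beta> ^ n"
    by (simp add: k) (simp add: \<alpha> \<beta> algebra_simps)
  finally show ?thesis .
qed

lemma scale_power: "scale c x ^ n = scale (c ^ n) (x ^ n)"
  by (induction n) (simp_all add: scale_mult_left scale_mult_right)

lemma inf_operator_scale: "inf_operator \<phi> (scale c x2)"
  using infinitesimal by (simp add: inf_operator_def scale_power phi_scale)

end

theorem theorem3p6:
  fixes scale :: "complex \<Rightarrow> 'a::ring_1 \<Rightarrow> 'a"
    and \<phi> \<phi>' :: "'a \<Rightarrow> complex"
    and x1 x2 p :: 'a
    and s \<alpha> \<beta> :: complex
  assumes "inf_prob_space scale \<phi> \<phi>'"
    and "inf_free_elements scale \<phi> \<phi>' x1 x2"
    and "inf_operator \<phi> x2"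
    and "s ^ 2 = moment \<phi> 2 x1"
    and "p = x1 * x2 + x2 * x1"
    and "\<alpha> = moment \<phi> 1 x1 + s"
    and "\<beta> = moment \<phi> 1 x1 - s"
  shows "inf_operator \<phi> p \<and>
    (\<forall>n\<ge>1. inf_cumulant \<phi> \<phi>' n p = moment \<phi>' n p \<and>
            moment \<phi>' n p =
              inf_cumulant \<phi> \<phi>' n (scale \<alpha> x2) + inf_cumulant \<phi> \<phi>' n (scale \<beta> x2)) \<and>
    inf_cauchy \<phi>' p = inf_cauchy \<phi>' (scale \<alpha> x2) + inf_cauchy \<phi>' (scale \<beta> x2) \<and>
    inf_r_transform \<phi> \<phi>' p =
      inf_r_transform \<phi> \<phi>' (scale \<alpha> x2) + inf_r_transform \<phi> \<phi>' (scale \<beta> x2)"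
proof -
  interpret inf_prob_space scale \<phi> \<phi>' by (rule assms(1))
  interpret free_with_infinitesimal scale \<phi> \<phi>' x1 x2
    by unfold_locales (rule assms(2,3))+
  have p: "p = free_with_infinitesimal.p x1 x2"
    by (simp add: assms(5) p_def)
  have op: "inf_operator \<phi> p"
    using inf_operator_p by (simp add: p)
  have moments: "moment \<phi>' n p = moment \<phi>' n (scale \<alpha> x2) + moment \<phi>' n (scale \<beta> x2)"
    if "1 \<le> n" for n
    using phi'_p_power[of s \<alpha> \<beta> n] that assms(4,6,7)
    by (simp add: moment_def p scale_power phi'_scale distrib_right)
  have cumulants: "inf_cumulant \<phi> \<phi>' n p = moment \<phi>' n p"
    "inf_cumulant \<phi> \<phi>' n (scale c x2) = moment \<phi>' n (scale c x2)" if "1 \<le> n" for n c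
    using that op inf_operator_scale by (simp_all add: inf_cumulant_inf_operator)
  have "inf_cauchy \<phi>' p = inf_cauchy \<phi>' (scale \<alpha> x2) + inf_cauchy \<phi>' (scale \<beta> x2)"
    by (rule fps_ext) (simp add: inf_cauchy_def moments)
  moreover have "inf_r_transform \<phi> \<phi>' p =
      inf_r_transform \<phi> \<phi>' (scale \<alpha> x2) + inf_r_transform \<phi> \<phi>' (scale \<beta> x2)"
    by (rule fps_ext) (simp add: inf_r_transform_def moments cumulants)
  ultimately show ?thesis
    using op moments cumulants by simp
qed

end
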